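(* Let $M\in\mathbb{R}^{n\times n}$ be a positive-definite matrix whose condition number satisfies $\kappa(M)\leq\tilde\kappa$. For any $k\in\{1,\ldots,n\}$, the following hold: 1. The distribution of $Y_k(M)$ has bounded support that is contained in an interval whose length is no greater than $\min\{k,n-k\}\cdot\log\tilde\kappa$. 2. The variance of $Y_k(M)$ satisfies $$\operatorname{var}(Y_k(M))\leq\frac14\left(\min\{k,n-k\}\cdot\log\tilde\kappa\right)^2.$$
   Context: Positive-definite matrices are real symmetric with all eigenvalues positive. For a positive-definite $n\times n$ matrix $M$ with eigenvalues $\lambda_1(M)\geq\cdots\geq\lambda_n(M)>0$, the condition number is $\kappa(M)=\lambda_1(M)/\lambda_n(M)$. For a $k$-element index set $I\subseteq\{1,\ldots,n\}$, $M_I:=[M_{i,j}]_{i,j\in I}$ is the corresponding principal $k\times k$ submatrix of $M$. The random matrix $A_k(M)$ is $M_I$ with $I$ chosen uniformly at random among the $\binom{n}{k}$ $k$-element subsets of $\{1,\ldots,n\}$, and $Y_k(M):=\log(\det A_k(M))$. Here $\log$ is the logarithm to a fixed base greater than $1$, the same one throughout. *)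

theory Defs
  imports
    "HOL-Probability.Probability_Mass_Function"
    "Jordan_Normal_Form.Char_Poly"
    "Jordan_Normal_Form.DL_Submatrix"
begin

text \<open>
  Matrices are those of \<^theory>\<open>Jordan_Normal_Form.Matrix\<close>, so rows and columns are indexed from 0
  and the index set of an n by n matrix is \<open>{..<n}\<close>.
\<close>

definition pos_def_mat :: "real mat \<Rightarrow> bool" where
  "pos_def_mat M \<longleftrightarrow> square_mat M \<and> transpose_mat M = M \<and> (\<forall>e. eigenvalue M e \<longrightarrow> e > 0)"

text \<open>
  The eigenvalues with algebraic multiplicity, i.e. the real roots of the characteristic
  polynomial, in descending order. A symmetric matrix of dimension n has n of them, and then
  \<open>eigval i M\<close> is the i-th largest one for i in \<open>{1..n}\<close>.
\<close>

definition eigvals_desc :: "real mat \<Rightarrow> real list" where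
  "eigvals_desc M = rev (sorted_list_of_multiset (proots (char_poly M)))"

definition eigval :: "nat \<Rightarrow> real mat \<Rightarrow> real" where
  "eigval i M = eigvals_desc M ! (i - 1)"

definition cond_num :: "real mat \<Rightarrow> real" where
  "cond_num M = eigval 1 M / eigval (dim_row M) M"

definition principal_submatrix :: "real mat \<Rightarrow> nat set \<Rightarrow> real mat" where
  "principal_submatrix M I = submatrix M I I"

text \<open>
  The random matrix \<open>A\<^sub>k(M)\<close> and the random variable \<open>Y\<^sub>k(M)\<close> are represented by their
  distributions; \<open>b\<close> is the base of the logarithm.
\<close>

definition A_dist :: "nat \<Rightarrow> real mat \<Rightarrow> real mat pmf" where
  "A_dist k M =
     map_pmf (principal_submatrix M) (pmf_of_set {I. I \<subseteq> {..<dim_row M} \<and> card I = k})"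

definition Y_dist :: "real \<Rightarrow> nat \<Rightarrow> real mat \<Rightarrow> real pmf" where
  "Y_dist b k M = map_pmf (\<lambda>A. log b (Determinant.det A)) (A_dist k M)"

end

theory Submission
  imports Defs
begin

text \<open>
  Order the indices so that those of \<open>I\<close> come first. Consecutive leading principal minors of
  the reordered matrix have a quotient between the extreme eigenvalues of \<open>M\<close>, which bound the
  Rayleigh quotient. Multiplying the first \<open>k\<close> quotients puts \<open>det M\<^sub>I\<close> between
  \<open>\<lambda>\<^sub>n\<^sup>k\<close> and \<open>\<lambda>\<^sub>1\<^sup>k\<close>; multiplying the last \<open>n - k\<close> puts \<open>det M / det M\<^sub>I\<close> between the
  \<open>(n - k)\<close>-th powers. Either range, in logarithms, contains the support, and a
  distribution on an interval of length \<open>L\<close> has variance at most \<open>L\<^sup>2 / 4\<close>.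
\<close>

unbundle no inner_syntax
unbundle no vec_syntax

section \<open>Rayleigh bounds\<close>

definition quad_form :: "real mat \<Rightarrow> real Matrix.vec \<Rightarrow> real" where
  "quad_form A x = x \<bullet> (A *\<^sub>v x)"

lemma scalar_prod_self_nonneg: "0 \<le> x \<bullet> (x :: real Matrix.vec)"
  unfolding scalar_prod_def by (auto intro: sum_nonneg)

lemma square_entry_le_scalar_prod:
  assumes "(x :: real Matrix.vec) \<in> carrier_vec n" and "i < n"
  shows "(x $ i)\<^sup>2 \<le> x \<bullet> x"
proof -
  have "(x $ i)\<^sup>2 = (\<Sum>j\<in>{i}. x $ j * x $ j)" by (simp add: power2_eq_square)
  also have "\<dots> \<le> (\<Sum>j = 0..<dim_vec x. x $ j * x $ j)"
    by (rule sum_mono2) (use assms in auto)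
  finally show ?thesis by (simp add: scalar_prod_def)
qed

lemma symmetric_scalar_prod_swap:
  assumes A: "(A :: real mat) \<in> carrier_mat n n" and sym: "transpose_mat A = A"
    and x: "x \<in> carrier_vec n" and y: "y \<in> carrier_vec n"
  shows "x \<bullet> (A *\<^sub>v y) = y \<bullet> (A *\<^sub>v x)"
proof -
  have "x \<bullet> (A *\<^sub>v y) = (transpose_mat A *\<^sub>v x) \<bullet> y"
    using A x y by (simp add: transpose_vec_mult_scalar)
  also have "\<dots> = y \<bullet> (A *\<^sub>v x)"
    unfolding sym using A x y by (intro comm_scalar_prod) auto
  finally show ?thesis .
qed

lemma mult_mat_vec_bounded:
  assumes A: "(A :: real mat) \<in> carrier_mat n n"
  obtains L where "L > 0"
    and "\<And>x. x \<in> carrier_vec n \<Longrightarrow> (A *\<^sub>v x) \<bullet> (A *\<^sub>v x) \<le> L * (x \<bullet> x)"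
proof
  \<comment> \<open>The squared Frobenius norm, by Cauchy-Schwarz on each row. The summand 1 keeps
    \<open>L\<close> positive for the zero matrix, so that it can serve as a divisor later.\<close>
  define L where "L = 1 + (\<Sum>i<n. \<Sum>j<n. (A $$ (i,j))\<^sup>2)"
  show "L > 0" unfolding L_def by (intro add_pos_nonneg sum_nonneg) auto
  fix x :: "real Matrix.vec" assume x: "x \<in> carrier_vec n"
  have xx: "x \<bullet> x = (\<Sum>j<n. (x $ j)\<^sup>2)"
    using x by (simp add: scalar_prod_def power2_eq_square atLeast0LessThan)
  have "(A *\<^sub>v x) \<bullet> (A *\<^sub>v x) = (\<Sum>i<n. (\<Sum>j<n. A $$ (i,j) * x $ j)\<^sup>2)"
    using A x by (auto simp: scalar_prod_def power2_eq_square atLeast0LessThan intro!: sum.cong)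
  also have "\<dots> \<le> (\<Sum>i<n. (\<Sum>j<n. (A $$ (i,j))\<^sup>2) * (\<Sum>j<n. (x $ j)\<^sup>2))"
    by (intro sum_mono Cauchy_Schwarz_ineq_sum)
  also have "\<dots> = (L - 1) * (x \<bullet> x)"
    unfolding xx L_def by (simp add: sum_distrib_right)
  also have "\<dots> \<le> L * (x \<bullet> x)"
    using scalar_prod_self_nonneg[of x] by (simp add: algebra_simps)
  finally show "(A *\<^sub>v x) \<bullet> (A *\<^sub>v x) \<le> L * (x \<bullet> x)" .
qed

text \<open>The squared norms of \<open>x - A x\<close> and \<open>x + A x\<close> are nonnegative,
  so twice the absolute value of the form is at most \<open>x \<bullet> x\<close> plus the squared
  norm of \<open>A x\<close>.\<close>

lemma quad_form_bounded:
  assumes A: "A \<in> carrier_mat n n"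
  obtains L where "L > 0"
    and "\<And>x. x \<in> carrier_vec n \<Longrightarrow> \<bar>quad_form A x\<bar> \<le> L * (x \<bullet> x)"
proof -
  obtain K where K: "K > 0"
    "\<And>x. x \<in> carrier_vec n \<Longrightarrow> (A *\<^sub>v x) \<bullet> (A *\<^sub>v x) \<le> K * (x \<bullet> x)"
    using mult_mat_vec_bounded[OF A] by blast
  have "\<bar>quad_form A x\<bar> \<le> (1 + K) * (x \<bullet> x)" if x: "x \<in> carrier_vec n" for x
  proof -
    have Ax: "A *\<^sub>v x \<in> carrier_vec n" using A x by auto
    have c: "(A *\<^sub>v x) \<bullet> x = x \<bullet> (A *\<^sub>v x)" using Ax x by (rule comm_scalar_prod)
    have "0 \<le> (x - A *\<^sub>v x) \<bullet> (x - A *\<^sub>v x)" "0 \<le> (x + A *\<^sub>v x) \<bullet> (x + A *\<^sub>v x)"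
      by (rule scalar_prod_self_nonneg)+
    moreover have "(x - A *\<^sub>v x) \<bullet> (x - A *\<^sub>v x) = x \<bullet> x - 2 * quad_form A x + (A *\<^sub>v x) \<bullet> (A *\<^sub>v x)"
      using Ax x by (simp add: minus_scalar_prod_distrib[of _ n] scalar_prod_minus_distrib[of _ n] c quad_form_def)
    moreover have "(x + A *\<^sub>v x) \<bullet> (x + A *\<^sub>v x) = x \<bullet> x + 2 * quad_form A x + (A *\<^sub>v x) \<bullet> (A *\<^sub>v x)"
      using Ax x by (simp add: add_scalar_prod_distrib[of _ n] scalar_prod_add_distrib[of _ n] c quad_form_def)
    ultimately show ?thesis
      using K(2)[OF x] scalar_prod_self_nonneg[of x] K(1)
      unfolding distrib_right by linarith
  qed
  with K(1) show thesis by (intro that[of "1 + K"]) auto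
qed

lemma quad_form_minus:
  assumes "A \<in> carrier_mat n n" "transpose_mat A = A" "x \<in> carrier_vec n" "y \<in> carrier_vec n"
  shows "quad_form A (x - s \<cdot>\<^sub>v y) = quad_form A x - 2 * s * (y \<bullet> (A *\<^sub>v x)) + s\<^sup>2 * quad_form A y"
proof -
  have c: "x \<bullet> (A *\<^sub>v y) = y \<bullet> (A *\<^sub>v x)"
    using assms by (rule symmetric_scalar_prod_swap)
  have "A *\<^sub>v (x - s \<cdot>\<^sub>v y) = A *\<^sub>v x - s \<cdot>\<^sub>v (A *\<^sub>v y)"
    using assms by (simp add: mult_minus_distrib_mat_vec[of _ n n] mult_mat_vec[of _ n n])
  moreover have "A *\<^sub>v x \<in> carrier_vec n" "A *\<^sub>v y \<in> carrier_vec n" using assms by auto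
  ultimately show ?thesis
    using assms c
    by (simp add: quad_form_def minus_scalar_prod_distrib[of _ n] scalar_prod_minus_distrib[of _ n]
        power2_eq_square algebra_simps)
qed

lemma smult_one_mult_mat_vec:
  assumes "x \<in> carrier_vec n"
  shows "(a \<cdot>\<^sub>m 1\<^sub>m n) *\<^sub>v x = (a :: real) \<cdot>\<^sub>v x"
  using assms by (intro eq_vecI) auto

text \<open>Two estimates are chained, without compactness of the unit sphere. The adjugate recovers
  a multiple of \<open>x\<close> from \<open>A x\<close>, so the norm of \<open>A x\<close> controls
  that of \<open>x\<close>; semidefiniteness at a point shifted from \<open>x\<close> along
  \<open>A x\<close> shows that the form controls the norm of \<open>A x\<close>.\<close>

lemma psd_det_nonzero_coercive:
  assumes A: "A \<in> carrier_mat n n" and sym: "transpose_mat A = A"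
    and psd: "\<And>x. x \<in> carrier_vec n \<Longrightarrow> 0 \<le> quad_form A x"
    and det: "Determinant.det A \<noteq> 0"
  obtains c where "c > 0" and "\<And>x. x \<in> carrier_vec n \<Longrightarrow> c * (x \<bullet> x) \<le> quad_form A x"
proof -
  define d where "d = Determinant.det A"
  define D where "D = adj_mat A"
  have D: "D \<in> carrier_mat n n" and DA: "D * A = d \<cdot>\<^sub>m 1\<^sub>m n"
    using adj_mat[OF A] by (auto simp: D_def d_def)
  obtain K where K: "K > 0"
    "\<And>x. x \<in> carrier_vec n \<Longrightarrow> (D *\<^sub>v x) \<bullet> (D *\<^sub>v x) \<le> K * (x \<bullet> x)"
    using mult_mat_vec_bounded[OF D] by blast
  obtain L where L: "L > 0" "\<And>x. x \<in> carrier_vec n \<Longrightarrow> \<bar>quad_form A x\<bar> \<le> L * (x \<bullet> x)"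
    using quad_form_bounded[OF A] by blast
  have d: "d\<^sup>2 > 0" using det by (simp add: d_def)
  have "d\<^sup>2 / (K * L) * (x \<bullet> x) \<le> quad_form A x" if x: "x \<in> carrier_vec n" for x
  proof -
    define y where "y = A *\<^sub>v x"
    have y: "y \<in> carrier_vec n" using A x by (auto simp: y_def)
    have "D *\<^sub>v y = (D * A) *\<^sub>v x" using D A x by (simp add: y_def)
    also have "\<dots> = d \<cdot>\<^sub>v x" using x by (simp add: DA smult_one_mult_mat_vec)
    finally have "d\<^sup>2 * (x \<bullet> x) = (D *\<^sub>v y) \<bullet> (D *\<^sub>v y)"
      using x by (simp add: power2_eq_square)
    also have "\<dots> \<le> K * (y \<bullet> y)" by (rule K(2)[OF y])
    finally have 1: "d\<^sup>2 * (x \<bullet> x) \<le> K * (y \<bullet> y)" .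
    \<comment> \<open>A gradient descent step: 1/L minimises the bound \<open>quad_form A x - 2 * t
      * (y \<bullet> y) + t\<^sup>2 * L * (y \<bullet> y)\<close> over t.\<close>
    have "0 \<le> quad_form A (x - (1/L) \<cdot>\<^sub>v y)" using x y by (intro psd) auto
    also have "\<dots> = quad_form A x - 2 * (1/L) * (y \<bullet> y) + (1/L)\<^sup>2 * quad_form A y"
      using quad_form_minus[OF A sym x y, of "1/L"] by (simp only: y_def)
    also have "\<dots> \<le> quad_form A x - 2 * (1/L) * (y \<bullet> y) + (1/L)\<^sup>2 * (L * (y \<bullet> y))"
      using L(2)[OF y] by (intro add_left_mono mult_left_mono) auto
    also have "\<dots> = quad_form A x - (y \<bullet> y) / L"
      using L(1) by (simp add: power2_eq_square field_simps)
    finally have 2: "y \<bullet> y \<le> L * quad_form A x"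
      using L(1) by (simp add: field_simps)
    have "d\<^sup>2 * (x \<bullet> x) \<le> K * (L * quad_form A x)"
      using 1 mult_left_mono[OF 2, of K] K(1) by linarith
    then show ?thesis using K(1) L(1) by (simp add: field_simps)
  qed
  moreover have "d\<^sup>2 / (K * L) > 0" using d K(1) L(1) by simp
  ultimately show thesis using that by blast
qed

section \<open>Eigenvalues as bounds of the Rayleigh quotient\<close>

lemma quad_form_shift:
  assumes "A \<in> carrier_mat n n" "x \<in> carrier_vec n"
  shows "quad_form (A - a \<cdot>\<^sub>m 1\<^sub>m n) x = quad_form A x - a * (x \<bullet> x)"
proof -
  have "(A - a \<cdot>\<^sub>m 1\<^sub>m n) *\<^sub>v x = A *\<^sub>v x - a \<cdot>\<^sub>v x"
    using assms by (simp add: minus_mult_distrib_mat_vec[of _ n n] smult_one_mult_mat_vec)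
  moreover have "A *\<^sub>v x \<in> carrier_vec n" using assms by auto
  ultimately show ?thesis
    using assms by (simp add: quad_form_def scalar_prod_minus_distrib[of _ n])
qed

text \<open>
  If the infimum \<open>a\<close> of the Rayleigh quotient were not an eigenvalue, \<open>A - a I\<close> would be
  positive semidefinite and invertible, hence coercive, and \<open>a\<close> could be increased.
\<close>

lemma exists_eigenvalue_le_quad_form:
  assumes A: "A \<in> carrier_mat n n" and sym: "transpose_mat A = A" and n: "0 < n"
  obtains a where "eigenvalue A a" and "\<And>x. x \<in> carrier_vec n \<Longrightarrow> a * (x \<bullet> x) \<le> quad_form A x"
proof -
  define S where "S = {c. \<forall>x\<in>carrier_vec n. c * (x \<bullet> x) \<le> quad_form A x}"
  obtain L where L: "L > 0" "\<And>x. x \<in> carrier_vec n \<Longrightarrow> \<bar>quad_form A x\<bar> \<le> L * (x \<bullet> x)"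
    using quad_form_bounded[OF A] by blast
  have "- L \<in> S" unfolding S_def using L(2) by (force simp: abs_le_iff)
  then have S: "S \<noteq> {}" by blast
  define e where "e = (unit_vec n 0 :: real Matrix.vec)"
  have e: "e \<in> carrier_vec n" "e \<bullet> e = 1" using n by (auto simp: e_def)
  have "c \<le> quad_form A e" if "c \<in> S" for c using that e by (auto simp: S_def dest: bspec[of _ _ e])
  then have bdd: "bdd_above S" by (rule bdd_aboveI)
  define a where "a = Sup S"
  have a: "a * (x \<bullet> x) \<le> quad_form A x" if x: "x \<in> carrier_vec n" for x
  proof (cases "x \<bullet> x = 0")
    \<comment> \<open>The Rayleigh quotient is undefined here, but the bound by \<open>L\<close>
      forces the form to vanish.\<close>
    case True
    then show ?thesis using L(2)[OF x] by simp
  next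
    case False
    then have pos: "x \<bullet> x > 0" using scalar_prod_self_nonneg[of x] by simp
    have "a \<le> quad_form A x / (x \<bullet> x)"
      unfolding a_def using S
      by (rule cSup_least) (use x pos in \<open>auto simp: S_def field_simps\<close>)
    then show ?thesis using pos by (simp add: field_simps)
  qed
  let ?C = "A - a \<cdot>\<^sub>m 1\<^sub>m n"
  have C: "?C \<in> carrier_mat n n" using A by auto
  have Csym: "transpose_mat ?C = ?C"
  proof (rule eq_matI)
    fix i j assume ij: "i < dim_row ?C" "j < dim_col ?C"
    have "A $$ (j, i) = A $$ (i, j)"
      using A ij arg_cong[OF sym, of "\<lambda>B. B $$ (i,j)"] by auto
    then show "transpose_mat ?C $$ (i, j) = ?C $$ (i, j)" using A ij by auto
  qed (use A in auto)
  have "Determinant.det ?C = 0"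
  proof (rule ccontr)
    assume "Determinant.det ?C \<noteq> 0"
    then obtain c where c: "c > 0" "\<And>x. x \<in> carrier_vec n \<Longrightarrow> c * (x \<bullet> x) \<le> quad_form ?C x"
      using psd_det_nonzero_coercive[OF C Csym] a quad_form_shift[OF A] by auto
    have "a + c \<in> S"
      unfolding S_def using c(2) quad_form_shift[OF A] by (force simp: distrib_right)
    then have "a + c \<le> a" unfolding a_def using bdd by (rule cSup_upper)
    with c(1) show False by simp
  qed
  moreover have char_eq: "char_matrix A a = ?C"
    using A by (intro eq_matI) (auto simp: char_matrix_def)
  ultimately have "eigenvalue A a"
    unfolding eigenvalue_det[OF A] char_eq by simp
  with a show thesis by (rule that[rotated])
qed

text \<open>Negation turns a lower bound for the form of \<open>- A\<close> into an upper bound for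
  that of \<open>A\<close>, and an eigenvalue \<open>a\<close> of \<open>- A\<close> into the
  eigenvalue \<open>- a\<close> of \<open>A\<close>.\<close>

lemma exists_eigenvalue_ge_quad_form:
  assumes A: "A \<in> carrier_mat n n" and sym: "transpose_mat A = A" and n: "0 < n"
  obtains a where "eigenvalue A a" and "\<And>x. x \<in> carrier_vec n \<Longrightarrow> quad_form A x \<le> a * (x \<bullet> x)"
proof -
  have m: "- A \<in> carrier_mat n n" "transpose_mat (- A) = - A"
    using A sym by (auto simp: transpose_uminus)
  obtain a where a: "eigenvalue (- A) a"
    "\<And>x. x \<in> carrier_vec n \<Longrightarrow> a * (x \<bullet> x) \<le> quad_form (- A) x"
    using exists_eigenvalue_le_quad_form[OF m n] by blast
  obtain v where v: "v \<in> carrier_vec n" "v \<noteq> 0\<^sub>v n" "(- A) *\<^sub>v v = a \<cdot>\<^sub>v v"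
    using a(1) A by (auto simp: eigenvalue_def eigenvector_def)
  have neg: "(- A) *\<^sub>v x = - (A *\<^sub>v x)" if "x \<in> carrier_vec n" for x
    using A that by (auto simp: uminus_mult_mat_vec)
  have "A *\<^sub>v v = - ((- A) *\<^sub>v v)" using neg[OF v(1)] A v by simp
  also have "\<dots> = (- a) \<cdot>\<^sub>v v" unfolding v(3) by auto
  finally have "eigenvalue A (- a)"
    unfolding eigenvalue_def eigenvector_def using v A by auto
  moreover have "quad_form A x \<le> (- a) * (x \<bullet> x)" if x: "x \<in> carrier_vec n" for x
    using a(2)[OF x] neg[OF x] A x by (simp add: quad_form_def)
  ultimately show thesis using that by blast
qed

section \<open>Real spectrum\<close>

text \<open>Split an eigenvector as u + i w with u and w real. Symmetry equates
  \<open>u \<bullet> (A *\<^sub>v w)\<close> with \<open>(A *\<^sub>v u) \<bullet> w\<close>; the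
  terms with \<open>Re \<mu>\<close> cancel, leaving \<open>Im \<mu>\<close> times the positive
  number \<open>u \<bullet> u + w \<bullet> w\<close>.\<close>

lemma symmetric_mat_eigenvalue_real:
  assumes A: "(A :: real mat) \<in> carrier_mat n n" and sym: "transpose_mat A = A"
    and ev: "eigenvalue (map_mat complex_of_real A) \<mu>"
  shows "Im \<mu> = 0"
proof -
  let ?A = "map_mat complex_of_real A"
  obtain v where v: "v \<in> carrier_vec n" "v \<noteq> 0\<^sub>v n" "?A *\<^sub>v v = \<mu> \<cdot>\<^sub>v v"
    using ev A by (auto simp: eigenvalue_def eigenvector_def)
  define u where "u = map_vec Re v"
  define w where "w = map_vec Im v"
  have u: "u \<in> carrier_vec n" and w: "w \<in> carrier_vec n" using v by (auto simp: u_def w_def)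
  have comp: "(\<Sum>j<n. of_real (A $$ (i,j)) * v $ j) = \<mu> * v $ i" if "i < n" for i
    using arg_cong[OF v(3), of "\<lambda>x. x $ i"] that A v(1)
    by (auto simp: scalar_prod_def atLeast0LessThan)
  have Au: "A *\<^sub>v u = Re \<mu> \<cdot>\<^sub>v u - Im \<mu> \<cdot>\<^sub>v w"
  proof (rule eq_vecI)
    fix i assume "i < dim_vec (Re \<mu> \<cdot>\<^sub>v u - Im \<mu> \<cdot>\<^sub>v w)"
    then have i: "i < n" using u w by auto
    show "(A *\<^sub>v u) $ i = (Re \<mu> \<cdot>\<^sub>v u - Im \<mu> \<cdot>\<^sub>v w) $ i"
      using arg_cong[OF comp[OF i], of Re] i A v(1)
      by (auto simp: scalar_prod_def u_def w_def atLeast0LessThan)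
  qed (use A w in auto)
  have Aw: "A *\<^sub>v w = Re \<mu> \<cdot>\<^sub>v w + Im \<mu> \<cdot>\<^sub>v u"
  proof (rule eq_vecI)
    fix i assume "i < dim_vec (Re \<mu> \<cdot>\<^sub>v w + Im \<mu> \<cdot>\<^sub>v u)"
    then have i: "i < n" using u w by auto
    show "(A *\<^sub>v w) $ i = (Re \<mu> \<cdot>\<^sub>v w + Im \<mu> \<cdot>\<^sub>v u) $ i"
      using arg_cong[OF comp[OF i], of Im] i A v(1)
      by (auto simp: scalar_prod_def u_def w_def atLeast0LessThan)
  qed (use A u in auto)
  have "u \<bullet> (A *\<^sub>v w) = (transpose_mat A *\<^sub>v u) \<bullet> w"
    using A u w by (simp add: transpose_vec_mult_scalar)
  also have "\<dots> = (A *\<^sub>v u) \<bullet> w" unfolding sym ..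
  finally have "Im \<mu> * (u \<bullet> u + w \<bullet> w) = 0"
    unfolding Au Aw using u w
    by (simp add: scalar_prod_add_distrib[of _ n] minus_scalar_prod_distrib[of _ n] distrib_left)
  moreover have "u \<bullet> u + w \<bullet> w \<noteq> 0"
  proof -
    obtain i where i: "i < n" "v $ i \<noteq> 0"
      using v by (metis carrier_vecD eq_vecI index_zero_vec(1) index_zero_vec(2))
    have "u \<bullet> u + w \<bullet> w = (\<Sum>j<n. (Re (v $ j))\<^sup>2 + (Im (v $ j))\<^sup>2)"
      using v(1) by (simp add: scalar_prod_def u_def w_def sum.distrib atLeast0LessThan power2_eq_square)
    also have "\<dots> > 0"
      by (rule sum_pos2[of _ i]) (use i in \<open>auto simp: complex_eq_iff sum_power2_gt_zero_iff\<close>)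
    finally show ?thesis by simp
  qed
  ultimately show ?thesis by simp
qed

text \<open>\<open>eigvals_desc\<close> collects real roots only. Since all complex roots are real,
  the complex factorization descends to the reals and the list has full length.\<close>

lemma symmetric_mat_char_poly_splits:
  assumes A: "(A :: real mat) \<in> carrier_mat n n" and sym: "transpose_mat A = A"
  obtains rs where "char_poly A = (\<Prod>r\<leftarrow>rs. [:- r, 1:])" and "length rs = n"
proof -
  let ?A = "map_mat complex_of_real A"
  have cA: "?A \<in> carrier_mat n n" using A by auto
  obtain as where as: "char_poly ?A = (\<Prod>a\<leftarrow>as. [:- a, 1:])" "length as = n"
    using char_poly_factorized[OF cA] by blast
  have re: "complex_of_real (Re a) = a" if "a \<in> set as" for a
  proof -
    have "poly (char_poly ?A) a = 0" unfolding as(1) using that by (rule linear_poly_root)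
    then have "Im a = 0"
      using symmetric_mat_eigenvalue_real[OF A sym] eigenvalue_root_char_poly[OF cA] by blast
    then show ?thesis by (simp add: complex_eq_iff)
  qed
  let ?p = "\<Prod>r\<leftarrow>map Re as. [:- r, 1:]"
  \<comment> \<open>Comparing values at real points suffices, as polynomials over an infinite field
    are determined by their values.\<close>
  have "poly (char_poly A) x = poly ?p x" for x
  proof -
    have "complex_of_real (poly (char_poly A) x) = poly (char_poly ?A) (of_real x)"
      unfolding of_real_hom.char_poly_hom[OF A] by simp
    also have "\<dots> = (\<Prod>a\<leftarrow>as. of_real x - a)"
      unfolding as(1) by (simp add: poly_prod_list o_def)
    also have "\<dots> = (\<Prod>a\<leftarrow>as. of_real (x - Re a))"
      by (intro arg_cong[of _ _ prod_list] map_cong) (auto simp: re)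
    also have "\<dots> = of_real (\<Prod>a\<leftarrow>as. x - Re a)"
      by (induction as) auto
    also have "\<dots> = of_real (poly ?p x)" by (simp add: poly_prod_list o_def)
    finally show ?thesis by (simp only: of_real_eq_iff)
  qed
  then have "char_poly A = ?p" by (simp add: fun_eq_iff flip: poly_eq_poly_eq_iff)
  then show thesis using as(2) by (intro that[of "map Re as"]) auto
qed

text \<open>Translates positions in the sorted root list into extremality in the spectrum. That the
  list has length \<open>n\<close> keeps both positions in range.\<close>

lemma eigval_extremal:
  assumes A: "A \<in> carrier_mat n n" and sym: "transpose_mat A = A" and n: "0 < n"
  shows "eigenvalue A (eigval 1 A)" and "eigenvalue A (eigval n A)"
    and "eigenvalue A e \<Longrightarrow> e \<le> eigval 1 A" and "eigenvalue A e \<Longrightarrow> eigval n A \<le> e"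
proof -
  obtain rs where rs: "char_poly A = (\<Prod>r\<leftarrow>rs. [:- r, 1:])" "length rs = n"
    using symmetric_mat_char_poly_splits[OF A sym] by blast
  have "proots (char_poly A) = mset rs"
    unfolding rs(1)
  proof (induction rs)
    case (Cons r rs)
    have "(\<Prod>r\<leftarrow>rs. [:- r, 1:]) \<noteq> 0" by (auto simp: prod_list_zero_iff)
    with Cons show ?case by (simp add: proots_mult del: mult_pCons_left)
  qed simp
  then have eq: "eigvals_desc A = rev (sort rs)" by (simp add: eigvals_desc_def)
  have ev: "eigenvalue A e \<longleftrightarrow> e \<in> set rs" for e
    unfolding eigenvalue_root_char_poly[OF A] rs(1) by (auto simp: poly_prod_list prod_list_zero_iff)
  have first: "eigval 1 A = sort rs ! (n - 1)" and last: "eigval n A = sort rs ! 0"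
    using n rs(2) by (auto simp: eigval_def eq rev_nth)
  have mem: "sort rs ! i \<in> set rs" if "i < n" for i
    using that rs(2) by (metis length_sort nth_mem set_sort)
  show "eigenvalue A (eigval 1 A)" "eigenvalue A (eigval n A)"
    unfolding ev first last using n by (auto intro: mem)
  show "e \<le> eigval 1 A" "eigval n A \<le> e" if e: "eigenvalue A e"
  proof -
    obtain i where "i < n" "e = sort rs ! i"
      using e rs(2) unfolding ev by (metis in_set_conv_nth length_sort set_sort)
    then show "e \<le> eigval 1 A" "eigval n A \<le> e"
      unfolding first last using rs(2) n by (auto intro!: sorted_nth_mono)
  qed
qed

section \<open>Principal minors\<close>

text \<open>With \<open>m\<close> equal to the dimension and \<open>f\<close> a permutation this
  reorders the matrix; smaller \<open>m\<close> with the same \<open>f\<close> gives the leading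
  blocks of the reordered matrix, so the blocks are nested.\<close>

definition reindex_mat :: "(nat \<Rightarrow> nat) \<Rightarrow> nat \<Rightarrow> 'a mat \<Rightarrow> 'a mat" where
  "reindex_mat f m A = Matrix.mat m m (\<lambda>(i, j). A $$ (f i, f j))"

lemma reindex_mat_carrier [simp]: "reindex_mat f m A \<in> carrier_mat m m"
  by (simp add: reindex_mat_def)

lemma reindex_mat_symmetric:
  assumes A: "A \<in> carrier_mat n n" and sym: "transpose_mat A = A" and f: "f ` {..<m} \<subseteq> {..<n}"
  shows "transpose_mat (reindex_mat f m A) = reindex_mat f m A"
proof (rule eq_matI)
  fix i j assume "i < dim_row (reindex_mat f m A)" "j < dim_col (reindex_mat f m A)"
  then have ij: "i < m" "j < m" by (auto simp: reindex_mat_def)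
  then have "f i < n" "f j < n" using f by auto
  then have "A $$ (f j, f i) = A $$ (f i, f j)"
    using A arg_cong[OF sym, of "\<lambda>B. B $$ (f i, f j)"] by auto
  then show "transpose_mat (reindex_mat f m A) $$ (i, j) = reindex_mat f m A $$ (i, j)"
    using ij by (simp add: reindex_mat_def)
qed (auto simp: reindex_mat_def)

text \<open>Rows and columns undergo the same permutation, so its sign occurs twice and cancels. The
  columns are treated as rows between two transpositions.\<close>

lemma det_reindex_permutes:
  fixes A :: "'a :: comm_ring_1 mat"
  assumes A: "A \<in> carrier_mat n n" and p: "p permutes {..<n}"
  shows "Determinant.det (reindex_mat p n A) = Determinant.det A"
proof -
  have p0: "p permutes {0..<n}" using p by (simp add: atLeast0LessThan)
  have lt: "p i < n" if "i < n" for i using permutes_in_image[OF p, of i] that by simp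
  let ?R = "\<lambda>B. Matrix.mat n n (\<lambda>(i, j). B $$ (p i, j))"
  have "reindex_mat p n A = transpose_mat (?R (transpose_mat (?R A)))"
    using A lt by (intro eq_matI) (auto simp: reindex_mat_def)
  then have "Determinant.det (reindex_mat p n A) = Determinant.det (?R (transpose_mat (?R A)))"
    by (simp add: det_transpose[of _ n])
  also have "\<dots> = signof p * Determinant.det (transpose_mat (?R A))"
    by (rule det_permute_rows[OF _ p0]) auto
  also have "Determinant.det (transpose_mat (?R A)) = signof p * Determinant.det A"
    by (subst det_transpose[of _ n]) (auto simp: det_permute_rows[OF A p0])
  also have "signof p * (signof p * Determinant.det A) = Determinant.det A"
    by (simp add: sign_def)
  finally show ?thesis .
qed

text \<open>Extending \<open>y\<close> by zero along \<open>f\<close> preserves norm and form, so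
  Rayleigh bounds pass from \<open>A\<close> to its principal submatrices.\<close>

lemma quad_form_reindex:
  assumes A: "A \<in> carrier_mat n n" and inj: "inj_on f {..<m}" and f: "f ` {..<m} \<subseteq> {..<n}"
    and y: "y \<in> carrier_vec m"
  obtains x where "x \<in> carrier_vec n" and "x \<bullet> x = y \<bullet> y"
    and "quad_form A x = quad_form (reindex_mat f m A) y"
proof
  define x where "x = Matrix.vec n
    (\<lambda>i. if i \<in> f ` {..<m} then y $ (inv_into {..<m} f i) else (0 :: real))"
  show x: "x \<in> carrier_vec n" by (simp add: x_def)
  \<comment> \<open>Arbitrary \<open>g\<close> lets the same identity handle the norm and both
    levels of the double sum in the form.\<close>
  have sum_x: "(\<Sum>i<n. x $ i * g i) = (\<Sum>j<m. y $ j * g (f j))" for g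
  proof -
    have "(\<Sum>i<n. x $ i * g i) = (\<Sum>i\<in>f ` {..<m}. x $ i * g i)"
      using f by (intro sum.mono_neutral_right) (auto simp: x_def)
    also have "\<dots> = (\<Sum>j<m. x $ f j * g (f j))" using inj by (subst sum.reindex) auto
    also have "\<dots> = (\<Sum>j<m. y $ j * g (f j))"
      using f inj by (intro sum.cong) (auto simp: x_def)
    finally show ?thesis .
  qed
  have x_f: "x $ f j = y $ j" if "j < m" for j using f inj that by (auto simp: x_def)
  have "x \<bullet> x = (\<Sum>i<n. x $ i * x $ i)" using x by (simp add: scalar_prod_def atLeast0LessThan)
  also have "\<dots> = (\<Sum>j<m. y $ j * y $ j)" unfolding sum_x by (simp add: x_f)
  also have "\<dots> = y \<bullet> y" using y by (simp add: scalar_prod_def atLeast0LessThan)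
  finally show "x \<bullet> x = y \<bullet> y" .
  have "quad_form A x = (\<Sum>i<n. x $ i * (\<Sum>j<n. x $ j * A $$ (i, j)))"
    unfolding quad_form_def using A x by (auto simp: scalar_prod_def atLeast0LessThan mult.commute intro!: sum.cong)
  also have "\<dots> = (\<Sum>i<m. y $ i * (\<Sum>j<m. y $ j * A $$ (f i, f j)))" unfolding sum_x ..
  also have "\<dots> = quad_form (reindex_mat f m A) y"
    unfolding quad_form_def using y
    by (auto simp: scalar_prod_def atLeast0LessThan mult.commute reindex_mat_def intro!: sum.cong)
  finally show "quad_form A x = quad_form (reindex_mat f m A) y" .
qed

text \<open>
  The last column \<open>z\<close> of the adjugate satisfies \<open>A z = det A \<cdot> e\<close> with last entry
  the leading minor \<open>d\<close>, so the quadratic form takes the value \<open>det A \<cdot> d\<close> at \<open>z\<close>.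
\<close>

lemma det_bordered_bounds:
  assumes A: "A \<in> carrier_mat (Suc m) (Suc m)" and sym: "transpose_mat A = A"
    and lower: "\<And>x. x \<in> carrier_vec (Suc m) \<Longrightarrow> \<alpha> * (x \<bullet> x) \<le> quad_form A x"
    and upper: "\<And>x. x \<in> carrier_vec (Suc m) \<Longrightarrow> quad_form A x \<le> \<beta> * (x \<bullet> x)"
    and \<alpha>: "0 < \<alpha>" and d: "0 < Determinant.det (mat_delete A m m)"
  shows "\<alpha> * Determinant.det (mat_delete A m m) \<le> Determinant.det A"
    and "Determinant.det A \<le> \<beta> * Determinant.det (mat_delete A m m)"
proof -
  define d where "d = Determinant.det (mat_delete A m m)"
  have dpos: "0 < d" using assms by (simp add: d_def)
  let ?n = "Suc m"
  let ?D = "Determinant.det A"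
  define e where "e = (unit_vec ?n m :: real Matrix.vec)"
  define z where "z = Matrix.col (adj_mat A) m"
  have e: "e \<in> carrier_vec ?n" "e \<bullet> e = 1" by (auto simp: e_def)
  have z: "z \<in> carrier_vec ?n" using adj_mat(1)[OF A] by (simp add: z_def carrier_vecI)
  have zm: "z $ m = d" using A by (simp add: z_def adj_mat_def cofactor_def d_def)
  have "A *\<^sub>v z = Matrix.col (A * adj_mat A) m"
    using A adj_mat(1)[OF A] by (simp add: z_def col_mult2[of _ ?n ?n] mult_mat_vec_def)
  also have "\<dots> = ?D \<cdot>\<^sub>v e"
    unfolding adj_mat(2)[OF A] by (intro eq_vecI) (auto simp: e_def unit_vec_def)
  finally have Az: "A *\<^sub>v z = ?D \<cdot>\<^sub>v e" .
  have qz: "quad_form A z = ?D * d"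
    unfolding quad_form_def Az using z e zm by (simp add: e_def)
  \<comment> \<open>The last entry of \<open>z\<close> is \<open>d\<close>, so
    \<open>z \<bullet> z\<close> is at least the square of \<open>d\<close>; one factor
    \<open>d\<close> then cancels.\<close>
  have "\<alpha> * d * d \<le> \<alpha> * (z \<bullet> z)"
    using square_entry_le_scalar_prod[OF z, of m] \<alpha> zm by (simp add: power2_eq_square)
  also have "\<dots> \<le> ?D * d" using lower[OF z] qz by simp
  finally show "\<alpha> * Determinant.det (mat_delete A m m) \<le> ?D"
    using dpos by (simp flip: d_def)
  have eAz: "e \<bullet> (A *\<^sub>v z) = ?D"
    unfolding Az using e by simp
  \<comment> \<open>Subtracting \<open>d\<close> times \<open>e\<close> removes the last entry of
    \<open>z\<close>. Expanding the form there leaves \<open>quad_form A e\<close>, the corner entry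
    of \<open>A\<close>, which is at most \<beta>.\<close>
  have "0 \<le> quad_form A (z - d \<cdot>\<^sub>v e)"
    using lower[of "z - d \<cdot>\<^sub>v e"] \<alpha> scalar_prod_self_nonneg[of "z - d \<cdot>\<^sub>v e"] z e
    by (smt (verit) minus_carrier_vec mult_nonneg_nonneg smult_carrier_vec)
  also have "\<dots> = ?D * d - 2 * d * ?D + d\<^sup>2 * quad_form A e"
    using quad_form_minus[OF A sym z e(1), of d] qz eAz by simp
  also have "\<dots> \<le> ?D * d - 2 * d * ?D + d\<^sup>2 * \<beta>"
    using upper[OF e(1)] e(2) by (intro add_left_mono mult_left_mono) auto
  also have "\<dots> = d * (\<beta> * d - ?D)" by (simp add: power2_eq_square algebra_simps)
  finally show "?D \<le> \<beta> * Determinant.det (mat_delete A m m)"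
    using dpos by (simp add: zero_le_mult_iff flip: d_def)
qed

section \<open>Chains of nested principal minors\<close>

lemma det_reindex_Suc_bounds:
  assumes A: "A \<in> carrier_mat n n" and sym: "transpose_mat A = A"
    and lower: "\<And>x. x \<in> carrier_vec n \<Longrightarrow> \<alpha> * (x \<bullet> x) \<le> quad_form A x"
    and upper: "\<And>x. x \<in> carrier_vec n \<Longrightarrow> quad_form A x \<le> \<beta> * (x \<bullet> x)"
    and \<alpha>: "0 < \<alpha>" and inj: "inj_on f {..<Suc m}" and f: "f ` {..<Suc m} \<subseteq> {..<n}"
    and pos: "0 < Determinant.det (reindex_mat f m A)"
  shows "\<alpha> * Determinant.det (reindex_mat f m A) \<le> Determinant.det (reindex_mat f (Suc m) A)"
    and "Determinant.det (reindex_mat f (Suc m) A) \<le> \<beta> * Determinant.det (reindex_mat f m A)"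
proof -
  let ?B = "reindex_mat f (Suc m) A"
  have del: "mat_delete ?B m m = reindex_mat f m A"
    by (intro eq_matI) (auto simp: mat_delete_def reindex_mat_def)
  have low: "\<alpha> * (y \<bullet> y) \<le> quad_form ?B y" and up: "quad_form ?B y \<le> \<beta> * (y \<bullet> y)"
    if "y \<in> carrier_vec (Suc m)" for y
    using quad_form_reindex[OF A inj f that] lower upper by metis+
  show "\<alpha> * Determinant.det (reindex_mat f m A) \<le> Determinant.det ?B"
    "Determinant.det ?B \<le> \<beta> * Determinant.det (reindex_mat f m A)"
    using det_bordered_bounds[OF reindex_mat_carrier reindex_mat_symmetric[OF A sym f] low up \<alpha>] pos
    unfolding del by auto
qed

lemma det_reindex_add_bounds:
  assumes A: "A \<in> carrier_mat n n" and sym: "transpose_mat A = A"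
    and lower: "\<And>x. x \<in> carrier_vec n \<Longrightarrow> \<alpha> * (x \<bullet> x) \<le> quad_form A x"
    and upper: "\<And>x. x \<in> carrier_vec n \<Longrightarrow> quad_form A x \<le> \<beta> * (x \<bullet> x)"
    and \<alpha>: "0 < \<alpha>" and inj: "inj_on f {..<m + k}" and f: "f ` {..<m + k} \<subseteq> {..<n}"
    and pos: "0 < Determinant.det (reindex_mat f m A)"
  shows "\<alpha> ^ k * Determinant.det (reindex_mat f m A) \<le> Determinant.det (reindex_mat f (m + k) A)
    \<and> Determinant.det (reindex_mat f (m + k) A) \<le> \<beta> ^ k * Determinant.det (reindex_mat f m A)"
  using inj f
proof (induction k)
  case 0
  then show ?case by simp
next
  case (Suc k)
  let ?d = "\<lambda>i. Determinant.det (reindex_mat f i A)"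
  have f': "inj_on f {..<Suc (m + k)}" "f ` {..<Suc (m + k)} \<subseteq> {..<n}"
    using Suc.prems by auto
  then have IH: "\<alpha> ^ k * ?d m \<le> ?d (m + k)" "?d (m + k) \<le> \<beta> ^ k * ?d m"
    using Suc.IH by (auto simp: inj_on_def image_subset_iff)
  have "0 < \<alpha> ^ k * ?d m" using \<alpha> pos by simp
  with IH(1) have p: "0 < ?d (m + k)" by linarith
  note b = det_reindex_Suc_bounds[OF A sym lower upper \<alpha> f' p]
  \<comment> \<open>Positivity of \<beta> is extracted from the two bounds on the new minor; it
    allows multiplying the upper induction hypothesis by \<beta>.\<close>
  have "\<alpha> * ?d (m + k) \<le> \<beta> * ?d (m + k)" using b by linarith
  then have \<beta>: "0 < \<beta>" using p \<alpha> by simp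
  have "\<alpha> * (\<alpha> ^ k * ?d m) \<le> \<alpha> * ?d (m + k)" using IH(1) \<alpha> by simp
  moreover have "\<beta> * ?d (m + k) \<le> \<beta> * (\<beta> ^ k * ?d m)" using IH(2) \<beta> by simp
  ultimately show ?case using b by (simp add: mult.assoc)
qed

text \<open>The chain from the empty minor up to \<open>I\<close> gives the first pair of bounds,
  the chain from \<open>I\<close> up to the whole matrix the second pair.\<close>

lemma det_principal_submatrix_bounds:
  assumes A: "A \<in> carrier_mat n n" and sym: "transpose_mat A = A"
    and lower: "\<And>x. x \<in> carrier_vec n \<Longrightarrow> \<alpha> * (x \<bullet> x) \<le> quad_form A x"
    and upper: "\<And>x. x \<in> carrier_vec n \<Longrightarrow> quad_form A x \<le> \<beta> * (x \<bullet> x)"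
    and \<alpha>: "0 < \<alpha>" and I: "I \<subseteq> {..<n}" "card I = k"
  defines "d \<equiv> Determinant.det (principal_submatrix A I)"
  shows "\<alpha> ^ k \<le> d" and "d \<le> \<beta> ^ k"
    and "\<alpha> ^ (n - k) * d \<le> Determinant.det A" and "Determinant.det A \<le> \<beta> ^ (n - k) * d"
proof -
  have finI: "finite I" using I(1) finite_subset by blast
  have kn: "k \<le> n" using I card_mono[of "{..<n}" I] by simp
  have pick_bij: "bij_betw (pick I) {..<k} I"
    unfolding bij_betw_def
  proof
    show inj: "inj_on (pick I) {..<k}"
      using I(2) by (auto intro!: linorder_inj_onI' dest: pick_mono_le[of _ I])
    have "pick I ` {..<k} \<subseteq> I" using I(2) pick_in_set_le by auto
    moreover have "card (pick I ` {..<k}) = card I" using inj I(2) by (simp add: card_image)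
    ultimately show "pick I ` {..<k} = I" using finI by (simp add: card_subset_eq)
  qed
  have "card {k..<n} = card ({..<n} - I)" using I finI by (simp add: card_Diff_subset)
  then obtain g where g: "bij_betw g {k..<n} ({..<n} - I)"
    using finite_same_card_bij[of "{k..<n}" "{..<n} - I"] by auto
  \<comment> \<open>\<open>pick I\<close> enumerates \<open>I\<close> in increasing order, as
    \<open>submatrix\<close> does. The complement may follow in any order, and the identity beyond
    \<open>n\<close> makes \<open>p\<close> a permutation in the sense of
    \<open>permutes\<close>.\<close>
  define p where "p i = (if i < k then pick I i else if i < n then g i else i)" for i
  have "bij_betw p {..<k} I"
    using pick_bij by (rule bij_betw_cong[THEN iffD1, rotated]) (simp add: p_def)
  moreover have "bij_betw p {k..<n} ({..<n} - I)"
    using g by (rule bij_betw_cong[THEN iffD1, rotated]) (simp add: p_def)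
  ultimately have "bij_betw p ({..<k} \<union> {k..<n}) (I \<union> ({..<n} - I))"
    by (intro bij_betw_combine) auto
  moreover have "{..<k} \<union> {k..<n} = {..<n}" "I \<union> ({..<n} - I) = {..<n}" using kn I by auto
  ultimately have bij: "bij_betw p {..<n} {..<n}" by simp
  then have perm: "p permutes {..<n}"
    by (rule bij_imp_permutes) (use kn in \<open>auto simp: p_def\<close>)
  have inj: "inj_on p {..<n}" and img: "p ` {..<n} \<subseteq> {..<n}" using bij by (auto simp: bij_betw_def)
  \<comment> \<open>\<open>submatrix\<close> takes its dimensions from the cardinality of this
    set.\<close>
  have "{i. i < n \<and> i \<in> I} = I" using I by auto
  then have "principal_submatrix A I = reindex_mat p k A"
    unfolding principal_submatrix_def submatrix_def using A I(2)
    by (intro eq_matI) (auto simp: reindex_mat_def p_def)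
  then have d: "Determinant.det (reindex_mat p k A) = d" by (simp add: d_def)
  have d0: "Determinant.det (reindex_mat p 0 A) = 1"
    by (simp add: det_dim_zero)
  have full: "Determinant.det (reindex_mat p n A) = Determinant.det A"
    using A perm by (rule det_reindex_permutes)
  have b0: "\<alpha> ^ k \<le> d \<and> d \<le> \<beta> ^ k"
    using det_reindex_add_bounds[OF A sym lower upper \<alpha>, of p 0 k]
      inj_on_subset[OF inj] image_mono[of "{..<k}" "{..<n}" p] img kn
    by (simp add: d d0)
  then show "\<alpha> ^ k \<le> d" "d \<le> \<beta> ^ k" by auto
  have "0 < d" using b0 \<alpha> zero_less_power[of \<alpha> k] by linarith
  then show "\<alpha> ^ (n - k) * d \<le> Determinant.det A" "Determinant.det A \<le> \<beta> ^ (n - k) * d"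
    using det_reindex_add_bounds[OF A sym lower upper \<alpha>, of p k "n - k"] inj img kn
    by (simp_all add: d full)
qed

section \<open>Variance\<close>

text \<open>Popoviciu's inequality: the variance is at most the mean squared distance from the
  midpoint \<open>c\<close>, and that distance never exceeds half the length.\<close>

lemma pmf_variance_le:
  fixes X :: "'a \<Rightarrow> real"
  assumes fin: "finite (set_pmf p)" and X: "\<And>x. x \<in> set_pmf p \<Longrightarrow> X x \<in> {l..u}"
  shows "measure_pmf.variance p X \<le> 1 / 4 * (u - l)\<^sup>2"
proof -
  let ?E = "measure_pmf.expectation p"
  define c where "c = (l + u) / 2"
  note [simp] = integrable_measure_pmf_finite[OF fin]
  have "measure_pmf.variance p X = ?E (\<lambda>x. (X x)\<^sup>2) - (?E X)\<^sup>2"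
    by (rule measure_pmf.variance_eq) auto
  \<comment> \<open>The two sides differ by the square of \<open>?E X - c\<close>.\<close>
  also have "\<dots> \<le> ?E (\<lambda>x. (X x)\<^sup>2) - 2 * c * ?E X + c\<^sup>2"
    using zero_le_power2[of "?E X - c"] by (simp add: power2_diff algebra_simps)
  also have "\<dots> = ?E (\<lambda>x. (X x)\<^sup>2 - 2 * c * X x + c\<^sup>2)" by simp
  also have "\<dots> \<le> ?E (\<lambda>x. ((u - l) / 2)\<^sup>2)"
  proof (rule integral_mono_AE)
    show "AE x in measure_pmf p. (X x)\<^sup>2 - 2 * c * X x + c\<^sup>2 \<le> ((u - l) / 2)\<^sup>2"
    proof (rule AE_pmfI)
      fix x assume "x \<in> set_pmf p"
      then have "\<bar>X x - c\<bar> \<le> (u - l) / 2" using X[of x] by (auto simp: c_def abs_le_iff field_simps)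
      then have "(X x - c)\<^sup>2 \<le> ((u - l) / 2)\<^sup>2" by (metis abs_ge_zero power2_abs power_mono)
      then show "(X x)\<^sup>2 - 2 * c * X x + c\<^sup>2 \<le> ((u - l) / 2)\<^sup>2" by (simp add: power2_diff algebra_simps)
    qed
  qed auto
  also have "\<dots> = 1 / 4 * (u - l)\<^sup>2" by (simp add: power_divide)
  finally show ?thesis .
qed

section \<open>Support and variance of the log-determinant\<close>

theorem theorem2:
  fixes M :: "real mat" and n k :: nat and \<kappa> b :: real
  assumes "b > 1"
    and "M \<in> carrier_mat n n"
    and "pos_def_mat M"
    and "cond_num M \<le> \<kappa>"
    and "k \<in> {1..n}"
  shows "(bounded (set_pmf (Y_dist b k M)) \<and>
          (\<exists>l u. l \<le> u \<and> set_pmf (Y_dist b k M) \<subseteq> {l..u} \<and>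
                 u - l \<le> real (min k (n - k)) * log b \<kappa>)) \<and>
         measure_pmf.variance (Y_dist b k M) (\<lambda>y. y)
           \<le> 1 / 4 * (real (min k (n - k)) * log b \<kappa>)\<^sup>2"
proof -
  let ?L = "real (min k (n - k)) * log b \<kappa>"
  let ?I = "{I. I \<subseteq> {..<dim_row M} \<and> card I = k}"
  have b: "1 < b" and M: "M \<in> carrier_mat n n" and k: "1 \<le> k" "k \<le> n" and n: "0 < n"
    using assms by auto
  have sym: "transpose_mat M = M" and pos: "\<And>e. eigenvalue M e \<Longrightarrow> 0 < e"
    using assms(3) by (auto simp: pos_def_mat_def)
  define \<alpha> where "\<alpha> = eigval n M"
  define \<beta> where "\<beta> = eigval 1 M"
  note ext = eigval_extremal[OF M sym n]
  have \<alpha>: "0 < \<alpha>" and \<beta>: "0 < \<beta>" and \<alpha>\<beta>: "\<alpha> \<le> \<beta>"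
    using ext pos by (auto simp: \<alpha>_def \<beta>_def)
  have lower: "\<alpha> * (x \<bullet> x) \<le> quad_form M x" if x: "x \<in> carrier_vec n" for x
  proof -
    obtain a where a: "eigenvalue M a" "\<And>x. x \<in> carrier_vec n \<Longrightarrow> a * (x \<bullet> x) \<le> quad_form M x"
      using exists_eigenvalue_le_quad_form[OF M sym n] by blast
    have "\<alpha> * (x \<bullet> x) \<le> a * (x \<bullet> x)"
      using ext(4)[OF a(1)] scalar_prod_self_nonneg by (simp add: \<alpha>_def mult_right_mono)
    with a(2)[OF x] show ?thesis by linarith
  qed
  have upper: "quad_form M x \<le> \<beta> * (x \<bullet> x)" if x: "x \<in> carrier_vec n" for x
  proof -
    obtain a where a: "eigenvalue M a" "\<And>x. x \<in> carrier_vec n \<Longrightarrow> quad_form M x \<le> a * (x \<bullet> x)"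
      using exists_eigenvalue_ge_quad_form[OF M sym n] by blast
    have "a * (x \<bullet> x) \<le> \<beta> * (x \<bullet> x)"
      using ext(3)[OF a(1)] scalar_prod_self_nonneg by (simp add: \<beta>_def mult_right_mono)
    with a(2)[OF x] show ?thesis by linarith
  qed
  define D where "D I = Determinant.det (principal_submatrix M I)" for I
  note bounds = det_principal_submatrix_bounds[OF M sym lower upper \<alpha>, folded D_def]
  have dim: "dim_row M = n" using M by simp
  have fin: "finite ?I" by (rule finite_subset[of _ "Pow {..<n}"]) (auto simp: dim)
  \<comment> \<open>\<open>set_pmf_of_set\<close> requires a nonempty finite set.\<close>
  have "{..<k} \<in> ?I" using k by (auto simp: dim)
  then have "?I \<noteq> {}" by blast
  then have supp: "set_pmf (Y_dist b k M) = (\<lambda>I. log b (D I)) ` ?I"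
    unfolding Y_dist_def A_dist_def using fin by (simp add: set_pmf_of_set image_image D_def)
  then have fin_supp: "finite (set_pmf (Y_dist b k M))" using fin by simp
  have "\<beta> / \<alpha> \<le> \<kappa>" using assms(4) by (simp add: cond_num_def \<alpha>_def \<beta>_def dim)
  moreover have "1 \<le> \<beta> / \<alpha>" using \<alpha> \<alpha>\<beta> by simp
  ultimately have "log b (\<beta> / \<alpha>) \<le> log b \<kappa>" using b by simp
  then have log_cond: "log b \<beta> - log b \<alpha> \<le> log b \<kappa>" using b \<alpha> \<beta> by (simp add: log_divide)
  have log_le: "log b x \<le> log b y" if "0 < x" "x \<le> y" for x y using b that by simp
  have "\<exists>l u. l \<le> u \<and> (\<forall>I\<in>?I. log b (D I) \<in> {l..u}) \<and> u - l \<le> ?L"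
  proof (cases "k \<le> n - k")
    case True
    let ?l = "real k * log b \<alpha>" and ?u = "real k * log b \<beta>"
    have "log b (D I) \<in> {?l..?u}" if I: "I \<in> ?I" for I
    proof -
      have "\<alpha> ^ k \<le> D I" "D I \<le> \<beta> ^ k" using bounds(1,2)[of I k] I dim by auto
      moreover have "0 < \<alpha> ^ k" using \<alpha> by simp
      ultimately have "log b (\<alpha> ^ k) \<le> log b (D I)" "log b (D I) \<le> log b (\<beta> ^ k)"
        by (auto intro: log_le)
      then show ?thesis using \<alpha> \<beta> by (simp add: log_nat_power)
    qed
    moreover have "?l \<le> ?u" using log_le[OF \<alpha> \<alpha>\<beta>] by (intro mult_left_mono) auto
    moreover have "?u - ?l \<le> ?L"
      using True mult_left_mono[OF log_cond, of "real k"] by (simp add: right_diff_distrib)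
    ultimately show ?thesis by blast
  next
    case False
    let ?m = "n - k"
    let ?t = "log b (Determinant.det M)"
    \<comment> \<open>Here \<open>D I\<close> is bounded through the quotient of
      \<open>det M\<close> by it, so \<beta> determines the lower endpoint and \<alpha> the upper
      one. For k = n the interval is a single point.\<close>
    let ?l = "?t - real ?m * log b \<beta>" and ?u = "?t - real ?m * log b \<alpha>"
    have "log b (D I) \<in> {?l..?u}" if I: "I \<in> ?I" for I
    proof -
      have "\<alpha> ^ k \<le> D I" using bounds(1)[of I k] I dim by auto
      moreover have "0 < \<alpha> ^ k" using \<alpha> by simp
      ultimately have D: "0 < D I" by linarith
      have d: "\<alpha> ^ ?m * D I \<le> Determinant.det M" "Determinant.det M \<le> \<beta> ^ ?m * D I"
        using bounds(3,4)[of I k] I dim by auto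
      have p: "0 < \<alpha> ^ ?m * D I" using \<alpha> D by simp
      have "log b (\<alpha> ^ ?m * D I) \<le> ?t" "?t \<le> log b (\<beta> ^ ?m * D I)"
        using log_le d p by auto
      then show ?thesis using \<alpha> \<beta> D by (simp add: log_nat_power log_mult)
    qed
    moreover have "?l \<le> ?u" using log_le[OF \<alpha> \<alpha>\<beta>] by (simp add: mult_left_mono)
    moreover have "?u - ?l \<le> ?L"
      using False mult_left_mono[OF log_cond, of "real ?m"] by (simp add: right_diff_distrib)
    ultimately show ?thesis by blast
  qed
  then obtain l u where lu: "l \<le> u" "set_pmf (Y_dist b k M) \<subseteq> {l..u}" "u - l \<le> ?L"
    unfolding supp by (metis (no_types, lifting) image_subsetI)
  have "measure_pmf.variance (Y_dist b k M) (\<lambda>y. y) \<le> 1 / 4 * (u - l)\<^sup>2"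
    using lu(2) by (intro pmf_variance_le fin_supp) auto
  \<comment> \<open>Squaring is monotone here because \<open>l \<le> u\<close> makes the length
    nonnegative.\<close>
  also have "\<dots> \<le> 1 / 4 * ?L\<^sup>2"
    using lu by (intro mult_left_mono power_mono) auto
  finally show ?thesis using lu finite_imp_bounded[OF fin_supp] by blast
qed

end
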